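(* Let $X$ be a Banach space which admits a Schauder frame (i.e. has the bounded approximation property). Then $X$ has a Schauder frame which is not shrinking.
   Context: Schauder frames are defined for infinite dimensional separable Banach spaces $X$: a sequence $(x_i,f_i)_{i=1}^\infty\subset X\times X^*$ is a Schauder frame for $X$ if $x=\sum_{i=1}^\infty f_i(x)x_i$ (norm convergence) for all $x\in X$. (A separable Banach space has a Schauder frame if and only if it has the bounded approximation property.) The frame is shrinking if $\|x^*\circ T_n\|\to 0$ for all $x^*\in X^*$, where $T_n:X\to X$ is $T_n(x)=\sum_{i\ge n}f_i(x)x_i$. *)

theory Defs
  imports "HOL-Analysis.Analysis"
begin

text \<open>A Banach space is a type of class \<^class>\<open>banach\<close> (real scalars), and \<open>'a \<Rightarrow>\<^sub>L real\<close> is its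
  dual. Sequences are indexed from \<open>0\<close>.\<close>

definition infinite_dimensional :: "'a::real_vector itself \<Rightarrow> bool" where
  "infinite_dimensional _ \<longleftrightarrow> \<not> (\<exists>B::'a set. finite B \<and> span B = UNIV)"

definition schauder_frame :: "(nat \<Rightarrow> 'a::banach) \<Rightarrow> (nat \<Rightarrow> 'a \<Rightarrow>\<^sub>L real) \<Rightarrow> bool" where
  "schauder_frame x f \<longleftrightarrow> (\<forall>z. (\<lambda>i. blinfun_apply (f i) z *\<^sub>R x i) sums z)"

definition frame_tail :: "(nat \<Rightarrow> 'a::banach) \<Rightarrow> (nat \<Rightarrow> 'a \<Rightarrow>\<^sub>L real) \<Rightarrow> nat \<Rightarrow> 'a \<Rightarrow> 'a" where
  "frame_tail x f n z = (\<Sum>i. blinfun_apply (f (n + i)) z *\<^sub>R x (n + i))"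

text \<open>For a Schauder frame, \<^term>\<open>frame_tail x f n\<close> is the identity minus a finite-rank
  bounded operator, hence bounded; so the operator norm \<^const>\<open>onorm\<close> below is the norm of
  the functional \<open>\<phi> \<circ> T\<^sub>n\<close> in the dual space.\<close>

lemma frame_tail_eq:
  assumes "schauder_frame x f"
  shows "frame_tail x f n z = z - (\<Sum>i<n. blinfun_apply (f i) z *\<^sub>R x i)"
proof -
  have s: "(\<lambda>i. blinfun_apply (f i) z *\<^sub>R x i) sums z"
    using assms by (simp add: schauder_frame_def)
  show ?thesis
    using suminf_minus_initial_segment[OF sums_summable[OF s], of n] sums_unique[OF s]
    by (simp add: frame_tail_def add.commute)
qed

lemma bounded_linear_frame_tail:
  assumes "schauder_frame x f"
  shows "bounded_linear (frame_tail x f n)"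
proof -
  have "bounded_linear (\<lambda>z. z - (\<Sum>i<n. blinfun_apply (f i) z *\<^sub>R x i))"
    by (intro bounded_linear_sub bounded_linear_ident bounded_linear_sum
        bounded_linear_scaleR_left[THEN bounded_linear_compose] blinfun.bounded_linear_right)
  then show ?thesis
    by (simp add: frame_tail_eq[OF assms, abs_def])
qed

definition shrinking :: "(nat \<Rightarrow> 'a::banach) \<Rightarrow> (nat \<Rightarrow> 'a \<Rightarrow>\<^sub>L real) \<Rightarrow> bool" where
  "shrinking x f \<longleftrightarrow>
     (\<forall>\<phi> :: 'a \<Rightarrow>\<^sub>L real. (\<lambda>n. onorm (blinfun_apply \<phi> \<circ> frame_tail x f n)) \<longlonglongrightarrow> 0)"

end

theory Submission
  imports Defs
begin

text \<open>If \<open>(x, f)\<close> is a Schauder frame with tail operators \<open>T\<^sub>n\<close>, infinite dimensionality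
  provides unit vectors \<open>u\<^sub>n\<close> annihilated by \<open>f\<^sub>0, \<dots>, f\<^sub>n\<^sub>-\<^sub>1\<close>, so that \<open>T\<^sub>n u\<^sub>n = u\<^sub>n\<close>. With norming
  functionals \<open>\<phi>\<^sub>n\<close> of \<open>u\<^sub>n\<close>, the functionals \<open>h\<^sub>n = \<phi>\<^sub>n \<circ> T\<^sub>n\<close> satisfy \<open>h\<^sub>n u\<^sub>n = 1\<close>, yet they are
  weak* null because \<open>\<bar>h\<^sub>n z\<bar> \<le> \<parallel>T\<^sub>n z\<parallel>\<close>; this replaces the Josefson--Nissenzweig theorem.
  Inserting the cancelling pairs \<open>(a, h\<^sub>n), (-a, h\<^sub>n)\<close> after \<open>(x\<^sub>n, f\<^sub>n)\<close>, for a fixed \<open>a \<noteq> 0\<close>, keeps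
  the frame property, but consecutive tails now differ by \<open>h\<^sub>n \<otimes> a\<close>, whose compositions with a
  functional that does not vanish at \<open>a\<close> stay away from \<open>0\<close> in norm.\<close>

section \<open>Norming functionals\<close>

text \<open>Homogeneity is only demanded as an inequality, the form that is easily checked for
  infima; scaling back by the inverse factor turns it into the equality
  \<open>sublinear_scaleR\<close>.\<close>

definition sublinear :: "('a::real_vector \<Rightarrow> real) \<Rightarrow> bool" where
  "sublinear q \<longleftrightarrow> (\<forall>x y. q (x + y) \<le> q x + q y) \<and> (\<forall>c x. 0 \<le> c \<longrightarrow> q (c *\<^sub>R x) \<le> c * q x)"

lemma sublinear_add: "sublinear q \<Longrightarrow> q (x + y) \<le> q x + q y"
  by (simp add: sublinear_def)

lemma sublinear_scaleR_le: "sublinear q \<Longrightarrow> 0 \<le> c \<Longrightarrow> q (c *\<^sub>R x) \<le> c * q x"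
  by (simp add: sublinear_def)

lemma sublinear_0:
  assumes "sublinear q"
  shows "q 0 = 0"
  using sublinear_add[OF assms, of 0 0] sublinear_scaleR_le[OF assms, of 0 0] by simp

lemma sublinear_minus_ge:
  assumes "sublinear q"
  shows "- q (- x) \<le> q x"
  using sublinear_add[OF assms, of x "- x"] sublinear_0[OF assms] by simp

lemma sublinear_scaleR:
  assumes "sublinear q" "0 \<le> c"
  shows "q (c *\<^sub>R x) = c * q x"
proof (cases "c = 0")
  case True
  then show ?thesis by (simp add: sublinear_0[OF assms(1)])
next
  case False
  with assms(2) have "0 < c" by simp
  have "q (inverse c *\<^sub>R (c *\<^sub>R x)) \<le> inverse c * q (c *\<^sub>R x)"
    using assms \<open>0 < c\<close> by (intro sublinear_scaleR_le) auto
  then have "c * q x \<le> q (c *\<^sub>R x)"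
    using \<open>0 < c\<close> by (simp add: field_simps)
  with sublinear_scaleR_le[OF assms] show ?thesis by (simp add: antisym)
qed

lemma sublinear_norm: "sublinear norm"
  by (simp add: sublinear_def norm_triangle_ineq)

text \<open>For sublinear \<open>q\<close> this is the largest sublinear functional below
  \<open>q\<close> whose value at \<open>- z\<close> is at most \<open>- q z\<close>.\<close>

definition lower_along :: "('a::real_vector \<Rightarrow> real) \<Rightarrow> 'a \<Rightarrow> 'a \<Rightarrow> real" where
  "lower_along q z x = (INF t\<in>{0..}. q (x + t *\<^sub>R z) - t * q z)"

lemma lower_along_le:
  assumes "sublinear q" "0 \<le> t"
  shows "lower_along q z x \<le> q (x + t *\<^sub>R z) - t * q z"
  unfolding lower_along_def
proof (rule cINF_lower)
  show "bdd_below ((\<lambda>t. q (x + t *\<^sub>R z) - t * q z) ` {0..})"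
  proof (rule bdd_belowI2)
    fix s :: real assume "s \<in> {0..}"
    \<comment> \<open>Homogeneity and subadditivity give \<open>s * q z = q (s *\<^sub>R z)\<close>
      \<le> \<open>q (x + s *\<^sub>R z) + q (- x)\<close>.\<close>
    then show "- q (- x) \<le> q (x + s *\<^sub>R z) - s * q z"
      using sublinear_add[OF assms(1), of "x + s *\<^sub>R z" "- x"] sublinear_scaleR[OF assms(1), of s z]
      by simp
  qed
qed (use assms in simp)

lemma lower_along_greatest:
  "(\<And>t. 0 \<le> t \<Longrightarrow> m \<le> q (x + t *\<^sub>R z) - t * q z) \<Longrightarrow> m \<le> lower_along q z x"
  unfolding lower_along_def by (rule cINF_greatest) auto

lemma lower_along_le_self: "sublinear q \<Longrightarrow> lower_along q z x \<le> q x"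
  using lower_along_le[of q 0 z x] by simp

lemma lower_along_minus: "sublinear q \<Longrightarrow> lower_along q z (- z) \<le> - q z"
  using lower_along_le[of q 1 z "- z"] by (simp add: sublinear_0)

text \<open>Parameters \<open>s\<close> for \<open>x\<close> and \<open>t\<close> for
  \<open>y\<close> combine to the parameter \<open>s + t\<close> for \<open>x + y\<close>, and
  \<open>t\<close> for \<open>x\<close> becomes \<open>c * t\<close> for
  \<open>c *\<^sub>R x\<close>. For the sum, the infima over \<open>t\<close> and \<open>s\<close>
  are taken one after the other.\<close>

lemma sublinear_lower_along:
  assumes "sublinear q"
  shows "sublinear (lower_along q z)"
  unfolding sublinear_def
proof (intro conjI allI impI)
  let ?D = "lower_along q z"
  fix x y
  have add: "?D (x + y) \<le> (q (x + s *\<^sub>R z) - s * q z) + (q (y + t *\<^sub>R z) - t * q z)"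
    if "0 \<le> s" "0 \<le> t" for s t
    using lower_along_le[OF assms, of "s + t" z "x + y"] that
      sublinear_add[OF assms, of "x + s *\<^sub>R z" "y + t *\<^sub>R z"]
    by (simp add: algebra_simps)
  have "?D (x + y) - (q (x + s *\<^sub>R z) - s * q z) \<le> ?D y" if "0 \<le> s" for s
  proof (rule lower_along_greatest)
    fix t :: real assume "0 \<le> t"
    with add[OF that this]
    show "?D (x + y) - (q (x + s *\<^sub>R z) - s * q z) \<le> q (y + t *\<^sub>R z) - t * q z"
      by linarith
  qed
  then have "?D (x + y) - ?D y \<le> ?D x"
    by (intro lower_along_greatest) (simp add: algebra_simps)
  then show "?D (x + y) \<le> ?D x + ?D y" by simp
next
  let ?D = "lower_along q z"
  fix c :: real and x assume "0 \<le> c"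
  show "?D (c *\<^sub>R x) \<le> c * ?D x"
  proof (cases "c = 0")
    case True
    then show ?thesis
      using lower_along_le_self[OF assms, of z 0] by (simp add: sublinear_0[OF assms])
  next
    case False
    with \<open>0 \<le> c\<close> have "0 < c" by simp
    have "?D (c *\<^sub>R x) / c \<le> ?D x"
    proof (rule lower_along_greatest)
      fix t :: real assume "0 \<le> t"
      have "?D (c *\<^sub>R x) \<le> q (c *\<^sub>R (x + t *\<^sub>R z)) - (c * t) * q z"
        using lower_along_le[OF assms, of "c * t" z "c *\<^sub>R x"] \<open>0 \<le> c\<close> \<open>0 \<le> t\<close>
        by (simp add: algebra_simps)
      also have "\<dots> = c * (q (x + t *\<^sub>R z) - t * q z)"
        by (simp add: sublinear_scaleR[OF assms \<open>0 \<le> c\<close>] right_diff_distrib)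
      finally show "?D (c *\<^sub>R x) / c \<le> q (x + t *\<^sub>R z) - t * q z"
        using \<open>0 < c\<close> by (simp add: field_simps)
    qed
    then show ?thesis using \<open>0 < c\<close> by (simp add: field_simps)
  qed
qed

text \<open>The pointwise infimum works: it is finite because each member is at least
  \<open>- p (- x)\<close> at \<open>x\<close>, and it is subadditive because of any two members the
  smaller one bounds both summands at once.\<close>

lemma sublinear_INF_chain:
  assumes C: "C \<noteq> {}" "\<And>q. q \<in> C \<Longrightarrow> sublinear q \<and> q \<le> p"
    and chain: "\<And>q r. q \<in> C \<Longrightarrow> r \<in> C \<Longrightarrow> q \<le> r \<or> r \<le> q"
  obtains u where "sublinear u" "\<And>q. q \<in> C \<Longrightarrow> u \<le> q"
proof
  let ?u = "\<lambda>x. INF q\<in>C. q x"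
  have lower: "?u x \<le> q x" if "q \<in> C" for q x
  proof (rule cINF_lower[OF bdd_belowI2 that])
    fix r assume "r \<in> C"
    then show "- p (- x) \<le> r x"
      using sublinear_minus_ge[of r x] C(2)[of r] le_funD[of r p "- x"] by force
  qed
  have greatest: "m \<le> ?u x" if "\<And>q. q \<in> C \<Longrightarrow> m \<le> q x" for m x
    using C(1) that by (rule cINF_greatest)
  show "?u \<le> q" if "q \<in> C" for q
    using lower[OF that] by (simp add: le_fun_def)
  show "sublinear ?u"
    unfolding sublinear_def
  proof (intro conjI allI impI)
    fix x y
    have add: "?u (x + y) \<le> q x + r y" if qr: "q \<in> C" "r \<in> C" for q r
    proof -
      obtain m where m: "m \<in> C" "m \<le> q" "m \<le> r"
        using chain[OF qr] qr by blast
      have "?u (x + y) \<le> m (x + y)" by (rule lower[OF m(1)])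
      also have "\<dots> \<le> m x + m y" using C(2)[OF m(1)] by (simp add: sublinear_add)
      also have "\<dots> \<le> q x + r y" using m by (simp add: le_fun_def add_mono)
      finally show ?thesis .
    qed
    have "?u (x + y) - q x \<le> ?u y" if "q \<in> C" for q
    proof (rule greatest)
      fix r assume "r \<in> C"
      with add[OF that this] show "?u (x + y) - q x \<le> r y" by linarith
    qed
    then have "?u (x + y) - ?u y \<le> ?u x"
      by (intro greatest) (simp add: algebra_simps)
    then show "?u (x + y) \<le> ?u x + ?u y" by simp
  next
    fix c :: real and x assume "0 \<le> c"
    have le: "?u (c *\<^sub>R x) \<le> c * q x" if "q \<in> C" for q
      using lower[OF that, of "c *\<^sub>R x"] C(2)[OF that] sublinear_scaleR_le[of q c x] \<open>0 \<le> c\<close> by simp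
    show "?u (c *\<^sub>R x) \<le> c * ?u x"
    proof (cases "c = 0")
      case True
      then show ?thesis using le C(1) by auto
    next
      case False
      with \<open>0 \<le> c\<close> have "0 < c" by simp
      then have "?u (c *\<^sub>R x) / c \<le> ?u x"
        using le by (intro greatest) (simp add: field_simps)
      then show ?thesis using \<open>0 < c\<close> by (simp add: field_simps)
    qed
  qed
qed

text \<open>A minimal sublinear functional \<open>q\<close> equals \<^term>\<open>lower_along q z\<close> for every \<open>z\<close>, which makes
  it odd.\<close>

lemma hahn_banach_sublinear:
  assumes "sublinear p"
  obtains q where "linear q" "q \<le> p"
proof -
  let ?A = "{q. sublinear q \<and> q \<le> p}"
  \<comment> \<open>The order is reversed, so that the maximal element given by Zorn's lemma is a
    minimal sublinear functional.\<close>
  let ?P = "\<lambda>q r. r \<le> q"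
  have "\<exists>m\<in>?A. \<forall>a\<in>?A. ?P m a \<longrightarrow> a = m"
  proof (rule predicate_Zorn)
    show "partial_order_on ?A (relation_of ?P ?A)"
      by (rule partial_order_on_relation_ofI) auto
    fix C assume C: "C \<in> Chains (relation_of ?P ?A)"
    then have sub: "q \<in> ?A" if "q \<in> C" for q
      using that by (auto simp: Chains_def relation_of_def)
    have chain: "q \<le> r \<or> r \<le> q" if "q \<in> C" "r \<in> C" for q r
      using C that by (auto simp: Chains_def relation_of_def)
    show "\<exists>u\<in>?A. \<forall>a\<in>C. ?P a u"
    proof (cases "C = {}")
      case True
      then show ?thesis using assms by auto
    next
      case False
      then obtain u where u: "sublinear u" "\<And>q. q \<in> C \<Longrightarrow> u \<le> q"
        using sublinear_INF_chain[of C p] sub chain by blast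
      with False sub have "u \<le> p" by (blast intro: order_trans)
      with u show ?thesis by blast
    qed
  qed
  then obtain q where q: "sublinear q" "q \<le> p"
    and min: "\<And>r. sublinear r \<Longrightarrow> r \<le> p \<Longrightarrow> r \<le> q \<Longrightarrow> r = q"
    by blast
  have "lower_along q z = q" for z
  proof (rule min)
    show "lower_along q z \<le> q" using q(1) by (simp add: le_fun_def lower_along_le_self)
    then show "lower_along q z \<le> p" using q(2) by (rule order_trans)
  qed (use q in \<open>simp add: sublinear_lower_along\<close>)
  then have minus: "q (- z) = - q z" for z
    using lower_along_minus[OF q(1), of z] sublinear_minus_ge[OF q(1), of z] by simp
  have "linear q"
  proof (rule linearI)
    fix x y
    show "q (x + y) = q x + q y"
      \<comment> \<open>Subadditivity at the negated arguments becomes superadditivity, since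
        \<open>q\<close> is odd.\<close>
      using sublinear_add[OF q(1), of x y] sublinear_add[OF q(1), of "- x" "- y"]
        minus[of "x + y"] by (simp add: minus)
  next
    fix c :: real and x
    show "q (c *\<^sub>R x) = c *\<^sub>R q x"
    proof (cases "0 \<le> c")
      case False
      then show ?thesis
        using sublinear_scaleR[OF q(1), of "- c" x] minus[of "c *\<^sub>R x"] by simp
    qed (simp add: sublinear_scaleR[OF q(1)])
  qed
  then show thesis using q(2) that by blast
qed

text \<open>Dominating by \<open>lower_along norm z\<close> instead of \<open>norm\<close> forces
  the value at \<open>- z\<close> down to \<open>- norm z\<close>, so no extension from the line
  through \<open>z\<close> is needed.\<close>

lemma norming_functional:
  fixes z :: "'a::real_normed_vector"
  obtains \<phi> :: "'a \<Rightarrow>\<^sub>L real" where "\<And>x. \<bar>blinfun_apply \<phi> x\<bar> \<le> norm x" "blinfun_apply \<phi> z = norm z"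
proof -
  obtain q where q: "linear q" "q \<le> lower_along norm z"
    using hahn_banach_sublinear[OF sublinear_lower_along[OF sublinear_norm]] by blast
  have le: "q x \<le> norm x" for x
    using le_funD[OF q(2), of x] lower_along_le_self[OF sublinear_norm, of z x] by simp
  have bound: "\<bar>q x\<bar> \<le> norm x" for x
    using le[of x] le[of "- x"] linear_neg[OF q(1), of x] by simp
  have "bounded_linear q"
    using q(1) bound
    by (intro bounded_linear_intro[of q 1]) (auto simp: linear_add linear_scale)
  moreover have "q z = norm z"
    using le[of z] le_funD[OF q(2), of "- z"] lower_along_minus[OF sublinear_norm, of z]
      linear_neg[OF q(1), of z] by simp
  ultimately show thesis
    using bound that[of "Blinfun q"] by (simp add: bounded_linear_Blinfun_apply)
qed

section \<open>Weak* null functionals bounded away from zero\<close>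

text \<open>Each functional lowers the dimension of the common kernel by at most one, so dropping
  the functionals one by one enlarges the spanning set by at most one vector each time.\<close>

lemma finite_span_if_common_kernel:
  fixes f :: "nat \<Rightarrow> 'a::real_vector \<Rightarrow> real"
  assumes "\<And>i. linear (f i)" "finite B" "{z. \<forall>i<n. f i z = 0} \<subseteq> span B"
  shows "\<exists>B'::'a set. finite B' \<and> span B' = UNIV"
  using assms(2,3)
proof (induction n arbitrary: B)
  case 0
  then show ?case by auto
next
  case (Suc n)
  show ?case
  proof (cases "\<forall>z. (\<forall>i<n. f i z = 0) \<longrightarrow> f n z = 0")
    case True
    then have "{z. \<forall>i<n. f i z = 0} \<subseteq> span B"
      using Suc.prems(2) by (auto simp: less_Suc_eq)
    with Suc show ?thesis by blast
  next
    case False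
    then obtain w where w: "\<And>i. i < n \<Longrightarrow> f i w = 0" "f n w \<noteq> 0" by blast
    have "{z. \<forall>i<n. f i z = 0} \<subseteq> span (insert w B)"
    proof
      fix z assume z: "z \<in> {z. \<forall>i<n. f i z = 0}"
      \<comment> \<open>The multiple of \<open>w\<close> is chosen to cancel \<open>f n z\<close>;
        the earlier functionals vanish at \<open>w\<close> and do not notice the correction.\<close>
      have "f i (z - (f n z / f n w) *\<^sub>R w) = 0" if "i < Suc n" for i
        using that w z by (auto simp: less_Suc_eq linear_diff[OF assms(1)] linear_scale[OF assms(1)])
      then have "z - (f n z / f n w) *\<^sub>R w \<in> span B"
        using Suc.prems(2) by auto
      then show "z \<in> span (insert w B)"
        by (auto simp: span_insert)
    qed
    with Suc.IH[of "insert w B"] Suc.prems(1) show ?thesis by blast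
  qed
qed

text \<open>A trivial common kernel would lie in the span of the empty set and make the whole space
  finitely spanned; a nonzero kernel vector is then normalized.\<close>

lemma infinite_dimensional_unit_vector_in_kernel:
  fixes f :: "nat \<Rightarrow> 'a::real_normed_vector \<Rightarrow>\<^sub>L real"
  assumes "infinite_dimensional TYPE('a)"
  obtains u where "norm u = 1" "\<And>i. i < n \<Longrightarrow> blinfun_apply (f i) u = 0"
proof -
  have "\<not> {z. \<forall>i<n. blinfun_apply (f i) z = 0} \<subseteq> span {}"
    using finite_span_if_common_kernel[of "\<lambda>i. blinfun_apply (f i)" "{}" n] assms
    by (auto simp: infinite_dimensional_def blinfun.bounded_linear_right bounded_linear.linear)
  then obtain z where "\<And>i. i < n \<Longrightarrow> blinfun_apply (f i) z = 0" "z \<noteq> 0" by auto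
  then show thesis
    using that[of "z /\<^sub>R norm z"] by (simp add: blinfun.scaleR_right)
qed

lemma frame_tail_tendsto_0:
  assumes "schauder_frame x f"
  shows "(\<lambda>n. frame_tail x f n z) \<longlonglongrightarrow> 0"
proof -
  have "(\<lambda>n. \<Sum>i<n. blinfun_apply (f i) z *\<^sub>R x i) \<longlonglongrightarrow> z"
    using assms by (simp add: schauder_frame_def sums_def)
  from tendsto_diff[OF tendsto_const[of z] this] show ?thesis
    by (simp add: frame_tail_eq[OF assms])
qed

lemma weak_star_null_functionals:
  fixes x :: "nat \<Rightarrow> 'a::banach"
  assumes "infinite_dimensional TYPE('a)" and frame: "schauder_frame x f"
  obtains h :: "nat \<Rightarrow> 'a \<Rightarrow>\<^sub>L real" and u where
    "\<And>z. (\<lambda>n. blinfun_apply (h n) z) \<longlonglongrightarrow> 0"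
    "\<And>n. norm (u n) = 1" "\<And>n. blinfun_apply (h n) (u n) = 1"
proof -
  have "\<exists>u. norm u = 1 \<and> (\<forall>i<n. blinfun_apply (f i) u = 0)" for n
    using infinite_dimensional_unit_vector_in_kernel[OF assms(1), of n f] by metis
  then obtain u where u: "\<And>n. norm (u n) = 1"
    and ker: "\<And>n i. i < n \<Longrightarrow> blinfun_apply (f i) (u n) = 0"
    by metis
  have "\<exists>\<phi> :: 'a \<Rightarrow>\<^sub>L real. (\<forall>z. \<bar>blinfun_apply \<phi> z\<bar> \<le> norm z) \<and> blinfun_apply \<phi> (u n) = norm (u n)" for n
    using norming_functional[of "u n"] by metis
  then obtain \<phi> :: "nat \<Rightarrow> 'a \<Rightarrow>\<^sub>L real" where \<phi>: "\<And>n z. \<bar>blinfun_apply (\<phi> n) z\<bar> \<le> norm z"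
    "\<And>n. blinfun_apply (\<phi> n) (u n) = norm (u n)"
    by metis
  define h where "h n = \<phi> n o\<^sub>L Blinfun (frame_tail x f n)" for n
  have h: "blinfun_apply (h n) z = blinfun_apply (\<phi> n) (frame_tail x f n z)" for n z
    by (simp add: h_def bounded_linear_Blinfun_apply bounded_linear_frame_tail[OF frame])
  show thesis
  proof
    show "(\<lambda>n. blinfun_apply (h n) z) \<longlonglongrightarrow> 0" for z
      using frame_tail_tendsto_0[OF frame, of z]
      by (rule tendsto_0_le[where K = 1]) (simp add: h \<phi>)
    show "blinfun_apply (h n) (u n) = 1" for n
      by (simp add: h frame_tail_eq[OF frame] ker \<phi> u)
  qed (rule u)
qed

section \<open>Inserting cancelling pairs into a frame\<close>

definition pad_vectors :: "(nat \<Rightarrow> 'a::real_vector) \<Rightarrow> 'a \<Rightarrow> nat \<Rightarrow> 'a" where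
  "pad_vectors x a k = (if k mod 3 = 0 then x (k div 3) else if k mod 3 = 1 then a else - a)"

text \<open>Both members of a pair carry the same functional; the opposite signs sit in
  \<open>pad_vectors\<close>.\<close>

definition pad_functionals :: "(nat \<Rightarrow> 'b) \<Rightarrow> (nat \<Rightarrow> 'b) \<Rightarrow> nat \<Rightarrow> 'b" where
  "pad_functionals f h k = (if k mod 3 = 0 then f (k div 3) else h (k div 3))"

text \<open>There are \<open>(n + 2) div 3\<close> multiples of 3 below \<open>n\<close>, one for
  each original term summed so far. A pair leaves a trace only when the sum stops between its two
  members, that is for \<open>n mod 3 = 2\<close>.\<close>

lemma padded_partial_sum:
  fixes f h :: "nat \<Rightarrow> 'a::real_normed_vector \<Rightarrow>\<^sub>L real"
  shows "(\<Sum>k<n. blinfun_apply (pad_functionals f h k) z *\<^sub>R pad_vectors x a k) =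
    (\<Sum>i<(n + 2) div 3. blinfun_apply (f i) z *\<^sub>R x i) +
    (if n mod 3 = 2 then blinfun_apply (h (n div 3)) z *\<^sub>R a else 0)"
proof (induction n)
  case 0
  then show ?case by simp
next
  case (Suc n)
  define m where "m = n div 3"
  consider "n = 3 * m" | "n = 3 * m + 1" | "n = 3 * m + 2"
    unfolding m_def by linarith
  then show ?case
  proof cases
    case 1
    have "(Suc n + 2) div 3 = Suc m" "(n + 2) div 3 = m" "n mod 3 = 0" "Suc n mod 3 = 1" "n div 3 = m"
      using 1 by presburger+
    then show ?thesis using Suc by (simp add: pad_vectors_def pad_functionals_def)
  next
    case 2
    have "(Suc n + 2) div 3 = Suc m" "(n + 2) div 3 = Suc m" "n mod 3 = 1" "Suc n mod 3 = 2"
      "n div 3 = m" "Suc n div 3 = m"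
      using 2 by presburger+
    then show ?thesis using Suc by (simp add: pad_vectors_def pad_functionals_def)
  next
    case 3
    have "(Suc n + 2) div 3 = Suc m" "(n + 2) div 3 = Suc m" "n mod 3 = 2" "Suc n mod 3 = 0" "n div 3 = m"
      using 3 by presburger+
    then show ?thesis using Suc by (simp add: pad_vectors_def pad_functionals_def)
  qed
qed

text \<open>The padded partial sums are the original ones run through more slowly, plus at most one
  uncancelled term, which tends to 0 since \<open>h\<close> is weak* null.\<close>

lemma schauder_frame_padded:
  fixes x :: "nat \<Rightarrow> 'a::banach"
  assumes "schauder_frame x f" and h: "\<And>z. (\<lambda>n. blinfun_apply (h n) z) \<longlonglongrightarrow> 0"
  shows "schauder_frame (pad_vectors x a) (pad_functionals f h)"
  unfolding schauder_frame_def sums_def padded_partial_sum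
proof
  fix z
  have "(\<lambda>n. \<Sum>i<n. blinfun_apply (f i) z *\<^sub>R x i) \<longlonglongrightarrow> z"
    using assms(1) by (simp add: schauder_frame_def sums_def)
  moreover have "filterlim (\<lambda>n::nat. (n + 2) div 3) sequentially sequentially"
    unfolding filterlim_at_top eventually_sequentially
    by (metis add_leD1 div_le_mono nonzero_mult_div_cancel_right trans_le_add1 zero_neq_numeral)
  ultimately have sums: "(\<lambda>n. \<Sum>i<(n + 2) div 3. blinfun_apply (f i) z *\<^sub>R x i) \<longlonglongrightarrow> z"
    by (rule filterlim_compose)
  have "filterlim (\<lambda>n::nat. n div 3) sequentially sequentially"
    unfolding filterlim_at_top eventually_sequentially
    by (metis div_le_mono nonzero_mult_div_cancel_right zero_neq_numeral)
  with h[of z] have "(\<lambda>n. blinfun_apply (h (n div 3)) z) \<longlonglongrightarrow> 0"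
    by (rule filterlim_compose)
  then have "(\<lambda>n. blinfun_apply (h (n div 3)) z *\<^sub>R a) \<longlonglongrightarrow> 0"
    by (rule tendsto_eq_intros) auto
  then have "(\<lambda>n. if n mod 3 = 2 then blinfun_apply (h (n div 3)) z *\<^sub>R a else 0) \<longlonglongrightarrow> 0"
    by (rule tendsto_0_le[where K = 1]) simp
  from tendsto_add[OF sums this]
  show "(\<lambda>n. (\<Sum>i<(n + 2) div 3. blinfun_apply (f i) z *\<^sub>R x i) +
      (if n mod 3 = 2 then blinfun_apply (h (n div 3)) z *\<^sub>R a else 0)) \<longlonglongrightarrow> z"
    by simp
qed

lemma not_shrinking_padded:
  fixes x :: "nat \<Rightarrow> 'a::banach"
  assumes frame: "schauder_frame (pad_vectors x a) (pad_functionals f h)"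
    and "a \<noteq> 0" and u: "\<And>n. norm (u n) = 1" "\<And>n. blinfun_apply (h n) (u n) = 1"
  shows "\<not> shrinking (pad_vectors x a) (pad_functionals f h)"
proof
  let ?T = "frame_tail (pad_vectors x a) (pad_functionals f h)"
  assume shr: "shrinking (pad_vectors x a) (pad_functionals f h)"
  obtain \<phi> :: "'a \<Rightarrow>\<^sub>L real" where \<phi>: "blinfun_apply \<phi> a = norm a"
    using norming_functional[of a] by blast
  define N where "N n = onorm (blinfun_apply \<phi> \<circ> ?T n)" for n
  have "N \<longlonglongrightarrow> 0"
    using shr unfolding shrinking_def N_def by blast
  have bound: "\<bar>blinfun_apply \<phi> (?T n (u m))\<bar> \<le> N n" for n m
  proof -
    have "bounded_linear (blinfun_apply \<phi> \<circ> ?T n)"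
      unfolding o_def
      by (rule bounded_linear_compose[OF blinfun.bounded_linear_right bounded_linear_frame_tail[OF frame]])
    from onorm[OF this, of "u m"] show ?thesis by (simp add: N_def u)
  qed
  have "norm a \<le> N (3 * n + 1) + N (3 * n + 2)" for n
  proof -
    \<comment> \<open>The two tails differ exactly by the term of index \<open>3 * n + 1\<close>,
      whose value at \<open>u n\<close> is \<open>a\<close> because \<open>h n\<close> is 1
      there.\<close>
    have "(3 * n + 1) mod 3 = 1" "(3 * n + 1) div 3 = n" by presburger+
    then have "?T (3 * n + 1) (u n) = ?T (3 * n + 2) (u n) + a"
      by (simp add: frame_tail_eq[OF frame] pad_vectors_def pad_functionals_def u)
    then have "norm a = blinfun_apply \<phi> (?T (3 * n + 1) (u n)) - blinfun_apply \<phi> (?T (3 * n + 2) (u n))"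
      by (simp add: blinfun.add_right \<phi>)
    with bound[of "3 * n + 1" n] bound[of "3 * n + 2" n] show ?thesis by linarith
  qed
  moreover have "(\<lambda>n. N (3 * n + 1) + N (3 * n + 2)) \<longlonglongrightarrow> 0 + 0"
  proof (rule tendsto_add)
    show "(\<lambda>n. N (3 * n + 1)) \<longlonglongrightarrow> 0" "(\<lambda>n. N (3 * n + 2)) \<longlonglongrightarrow> 0"
      using LIMSEQ_subseq_LIMSEQ[OF \<open>N \<longlonglongrightarrow> 0\<close>, of "\<lambda>n. 3 * n + 1"]
        LIMSEQ_subseq_LIMSEQ[OF \<open>N \<longlonglongrightarrow> 0\<close>, of "\<lambda>n. 3 * n + 2"]
      by (simp_all add: strict_mono_def o_def)
  qed
  \<comment> \<open>Were the frame shrinking, a null sequence would be bounded below by the constant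
    \<open>norm a\<close>.\<close>
  ultimately have "norm a \<le> 0"
    by (intro LIMSEQ_le_const[where X = "\<lambda>n. N (3 * n + 1) + N (3 * n + 2)"]) auto
  with \<open>a \<noteq> 0\<close> show False by simp
qed

theorem theorem2p3:
  assumes "infinite_dimensional TYPE('a::banach)"
    and "separable_space (euclidean :: 'a topology)"
    and "\<exists>(x :: nat \<Rightarrow> 'a) f. schauder_frame x f"
  shows "\<exists>(y :: nat \<Rightarrow> 'a) g. schauder_frame y g \<and> \<not> shrinking y g"
proof -
  obtain x :: "nat \<Rightarrow> 'a" and f where frame: "schauder_frame x f"
    using assms(3) by blast
  obtain h :: "nat \<Rightarrow> 'a \<Rightarrow>\<^sub>L real" and u where h: "\<And>z. (\<lambda>n. blinfun_apply (h n) z) \<longlonglongrightarrow> 0"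
    and u: "\<And>n. norm (u n) = 1" "\<And>n. blinfun_apply (h n) (u n) = 1"
    using weak_star_null_functionals[OF assms(1) frame] by blast
  \<comment> \<open>Any nonzero vector can be inserted; the unit vector \<open>u 0\<close> is one at
    hand.\<close>
  have padded: "schauder_frame (pad_vectors x (u 0)) (pad_functionals f h)"
    using frame h by (rule schauder_frame_padded)
  have "u 0 \<noteq> 0" using u(1)[of 0] by auto
  from not_shrinking_padded[OF padded this u] padded show ?thesis by blast
qed

end
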